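(* For every generalised Oxtoby sequence $x$ and for every $y \in X_x$ we have $|\mathrm{Aper}(y)| \in \{0,\infty\}$. In particular, for a generalised Oxtoby sequence $x$ with associated odometer $\Omega$, it is not the case that $\mathscr{O}(\omega) \cap B_X$ is finite for every $\omega \in \Omega$, and the set $B_X$ is not finite.
   Context: $\mathscr{A}$ is a finite alphabet; $\mathscr{A}^{\mathbb{Z}}$ carries the product topology and the left shift $\sigma(x)(j) = x(j+1)$. A word $x \in \mathscr{A}^{\mathbb{Z}}$ is a Toeplitz word if for every $j \in \mathbb{Z}$ there is $p \in \mathbb{N}$ with $x(j) = x(j+np)$ for all $n \in \mathbb{N}$ (equivalently, all $n\in\mathbb{Z}$). $X_x$ denotes the closure of $\{\sigma^n(x) : n \in \mathbb{Z}\}$. For a word $y$ put $\mathrm{Per}(p,y,a) = \{j \in \mathbb{Z} : y(j+np) = a \text{ for all } n \in \mathbb{Z}\}$, $\mathrm{Per}(p,y) = \bigcup_{a \in \mathscr{A}} \mathrm{Per}(p,y,a)$ and $\mathrm{Aper}(p,y) = \mathbb{Z} \setminus \mathrm{Per}(p,y)$. A period structure of a Toeplitz word $x$ is a sequence $(p_l)_{l \in \mathbb{N}}$ of positive integers with (i) $p_l \mid p_{l+1}$; (ii) $\emptyset \neq \mathrm{Per}(p_l,x) \neq \mathrm{Per}(p,x)$ for all $0<p<p_l$; (iii) $\bigcup_l \mathrm{Per}(p_l,x) = \mathbb{Z}$. For $y \in X_x$, $\mathrm{Aper}(y) = \mathbb{Z} \setminus \bigcup_l \mathrm{Per}(p_l,y)$.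 All intervals are intervals of integers. A Toeplitz word $x$ is a generalised Oxtoby sequence with respect to a period structure $(p_l)$ of $x$ if: (i) for every $l \in \mathbb{N}$ and every $k \in [0, \frac{p_{l+1}}{p_l}-1]$, the set $\mathrm{Aper}(p_{l+1},x) \cap [kp_l,(k+1)p_l-1]$ is either empty or equal to $\mathrm{Aper}(p_l,x) \cap [kp_l,(k+1)p_l-1]$; and (ii) for every $l \in \mathbb{N}$ there are at least two $k \in [0,\frac{p_{l+1}}{p_l}-1]$ such that $\mathrm{Aper}(p_{l+1},x) \cap [kp_l,(k+1)p_l-1]$ is non-empty. Here the convention $p_0 = 1$ is used when necessary, i.e. conditions (i) and (ii) are also understood for $l=0$. $x$ is a generalised Oxtoby sequence if it is one with respect to some period structure. The odometer associated to $x$ is $\Omega = \varprojlim \mathbb{Z}/p_l\mathbb{Z}$ with rotation $\varrho(\omega) = \omega + (1,1,1,\dots)$, and $\mathscr{O}(\omega) = \{\varrho^n(\omega) : n \in \mathbb{Z}\}$. Let $\eta(j) = (j \bmod p_1, j \bmod p_2, \dots) \in \Omega$ for $j \in \mathbb{Z}$, and let $F_x \subseteq \Omega \times \mathscr{A}$ be the closure of $\{(\eta(j),x(j)) : j \in \mathbb{Z}\}$. Then $B_X$ is the set of $\omega \in \Omega$ such that there are at least two letters $a$ with $(\omega,a) \in F_x$ (equivalently, the boundary of the separating cover of $\Omega$ by the sets $C_a = \{\omega : (\omega,a) \in F_x\}$). *)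

theory Defs
  imports "HOL-Analysis.Analysis"
begin

text \<open>
  Words over a finite alphabet are functions \<open>int \<Rightarrow> 'a\<close> with \<open>'a\<close> of class \<open>finite\<close>; the alphabet
  is the whole type.
\<close>

definition word_topology :: "(int \<Rightarrow> 'a) topology" where
  "word_topology = product_topology (\<lambda>_. discrete_topology UNIV) UNIV"

text \<open>\<open>shift n\<close> is the \<open>n\<close>-th iterate (\<open>n\<close> any integer) of the left shift \<open>shift 1\<close>.\<close>

definition shift :: "int \<Rightarrow> (int \<Rightarrow> 'a) \<Rightarrow> int \<Rightarrow> 'a" where
  "shift n x = (\<lambda>j. x (j + n))"

lemma shift_0: "shift 0 = id"
  by (simp add: shift_def fun_eq_iff)

lemma shift_add: "shift (m + n) = shift m \<circ> shift n"
  by (simp add: shift_def fun_eq_iff add.assoc)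

definition orbit_closure :: "(int \<Rightarrow> 'a) \<Rightarrow> (int \<Rightarrow> 'a) set" where
  "orbit_closure x = word_topology closure_of (range (\<lambda>n. shift n x))"

definition toeplitz :: "(int \<Rightarrow> 'a) \<Rightarrow> bool" where
  "toeplitz x \<longleftrightarrow> (\<forall>j. \<exists>p::nat. p > 0 \<and> (\<forall>n::nat. x j = x (j + int n * int p)))"

definition Per_letter :: "nat \<Rightarrow> (int \<Rightarrow> 'a) \<Rightarrow> 'a \<Rightarrow> int set" where
  "Per_letter p y a = {j. \<forall>n::int. y (j + n * int p) = a}"

definition Per :: "nat \<Rightarrow> (int \<Rightarrow> 'a) \<Rightarrow> int set" where
  "Per p y = (\<Union>a. Per_letter p y a)"

definition Aper :: "nat \<Rightarrow> (int \<Rightarrow> 'a) \<Rightarrow> int set" where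
  "Aper p y = UNIV - Per p y"

text \<open>
  A period structure \<open>(p\<^sub>l)\<close> is indexed by \<open>l \<ge> 1\<close>. It is encoded as a function on all of
  \<open>nat\<close> whose value at \<open>0\<close> is the conventional \<open>p\<^sub>0 = 1\<close>; the conditions on the structure itself
  are only imposed for \<open>l \<ge> 1\<close> (in particular \<open>Per 1 x\<close> may be empty).
\<close>

definition period_structure :: "(int \<Rightarrow> 'a) \<Rightarrow> (nat \<Rightarrow> nat) \<Rightarrow> bool" where
  "period_structure x p \<longleftrightarrow>
     toeplitz x \<and> p 0 = 1 \<and> (\<forall>l\<ge>1. p l > 0) \<and>
     (\<forall>l\<ge>1. p l dvd p (l + 1)) \<and>
     (\<forall>l\<ge>1. Per (p l) x \<noteq> {} \<and> (\<forall>q. 0 < q \<and> q < p l \<longrightarrow> Per (p l) x \<noteq> Per q x)) \<and>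
     (\<Union>l\<in>{1..}. Per (p l) x) = UNIV"

definition Aper_total :: "(nat \<Rightarrow> nat) \<Rightarrow> (int \<Rightarrow> 'a) \<Rightarrow> int set" where
  "Aper_total p y = UNIV - (\<Union>l\<in>{1..}. Per (p l) y)"

text \<open>\<open>block p l k\<close> is the integer interval \<open>[k p\<^sub>l, (k+1) p\<^sub>l - 1]\<close>.\<close>

definition block :: "(nat \<Rightarrow> nat) \<Rightarrow> nat \<Rightarrow> nat \<Rightarrow> int set" where
  "block p l k = {int k * int (p l) .. (int k + 1) * int (p l) - 1}"

definition generalised_oxtoby_wrt :: "(int \<Rightarrow> 'a) \<Rightarrow> (nat \<Rightarrow> nat) \<Rightarrow> bool" where
  "generalised_oxtoby_wrt x p \<longleftrightarrow>
     toeplitz x \<and> period_structure x p \<and>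
     (\<forall>l. \<forall>k < p (l + 1) div p l.
        Aper (p (l + 1)) x \<inter> block p l k = {} \<or>
        Aper (p (l + 1)) x \<inter> block p l k = Aper (p l) x \<inter> block p l k) \<and>
     (\<forall>l. card {k. k < p (l + 1) div p l \<and> Aper (p (l + 1)) x \<inter> block p l k \<noteq> {}} \<ge> 2)"

definition generalised_oxtoby :: "(int \<Rightarrow> 'a) \<Rightarrow> bool" where
  "generalised_oxtoby x \<longleftrightarrow> (\<exists>p. generalised_oxtoby_wrt x p)"

text \<open>
  The inverse limit of the groups \<open>\<int>/p\<^sub>l\<int>\<close>, whose elements are represented by their residues in
  \<open>{0..<p\<^sub>l}\<close>. Since \<open>p\<^sub>0 = 1\<close>, the coordinate \<open>l = 0\<close> is constantly \<open>0\<close> and has no influence.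
\<close>

definition odometer :: "(nat \<Rightarrow> nat) \<Rightarrow> (nat \<Rightarrow> int) set" where
  "odometer p = {\<omega>. \<forall>l. \<omega> l \<in> {0..<int (p l)} \<and> \<omega> (l + 1) mod int (p l) = \<omega> l}"

definition odometer_topology :: "(nat \<Rightarrow> nat) \<Rightarrow> (nat \<Rightarrow> int) topology" where
  "odometer_topology p =
     subtopology (product_topology (\<lambda>l. discrete_topology {0..<int (p l)}) UNIV) (odometer p)"

text \<open>\<open>rotation p n\<close> is the \<open>n\<close>-th iterate (\<open>n\<close> any integer) of \<open>\<omega> \<mapsto> \<omega> + (1,1,\<dots>)\<close>.\<close>

definition rotation :: "(nat \<Rightarrow> nat) \<Rightarrow> int \<Rightarrow> (nat \<Rightarrow> int) \<Rightarrow> nat \<Rightarrow> int" where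
  "rotation p n \<omega> = (\<lambda>l. (\<omega> l + n) mod int (p l))"

lemma rotation_0: "\<omega> \<in> odometer p \<Longrightarrow> rotation p 0 \<omega> = \<omega>"
  by (auto simp: rotation_def odometer_def fun_eq_iff)

lemma rotation_add: "rotation p (m + n) \<omega> = rotation p m (rotation p n \<omega>)"
  by (simp add: rotation_def fun_eq_iff mod_simps algebra_simps)

definition odometer_orbit :: "(nat \<Rightarrow> nat) \<Rightarrow> (nat \<Rightarrow> int) \<Rightarrow> (nat \<Rightarrow> int) set" where
  "odometer_orbit p \<omega> = range (\<lambda>n. rotation p n \<omega>)"

definition eta :: "(nat \<Rightarrow> nat) \<Rightarrow> int \<Rightarrow> nat \<Rightarrow> int" where
  "eta p j = (\<lambda>l. j mod int (p l))"

definition graph_closure :: "(nat \<Rightarrow> nat) \<Rightarrow> (int \<Rightarrow> 'a) \<Rightarrow> ((nat \<Rightarrow> int) \<times> 'a) set" where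
  "graph_closure p x =
     prod_topology (odometer_topology p) (discrete_topology UNIV)
       closure_of (range (\<lambda>j. (eta p j, x j)))"

definition boundary_set :: "(nat \<Rightarrow> nat) \<Rightarrow> (int \<Rightarrow> 'a) \<Rightarrow> (nat \<Rightarrow> int) set" where
  "boundary_set p x =
     {\<omega> \<in> odometer p. \<exists>a b. a \<noteq> b \<and> (\<omega>, a) \<in> graph_closure p x \<and> (\<omega>, b) \<in> graph_closure p x}"

end

theory Submission
  imports Defs
begin

text \<open>
  Let \<open>q\<close> be a period structure witnessing the Oxtoby property. A point \<open>y\<close> of the orbit closure
  has a phase \<open>c\<^sub>l mod q\<^sub>l\<close> at every level, with \<open>Aper(q\<^sub>l, y) = Aper(q\<^sub>l, x) - c\<^sub>l\<close>. If some position
  is aperiodic for \<open>y\<close>, then for every \<open>l\<close> the \<open>q\<^sub>l\<close>-block around it is never filled at later levels,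
  so it contributes \<open>|Aper(q\<^sub>l, x) \<inter> [0, q\<^sub>l - 1]|\<close> positions to \<open>Aper(y)\<close>. By condition (ii) this
  number at least doubles with \<open>l\<close>. The same argument for a point \<open>\<omega>\<close> of the odometer with
  \<open>\<omega>\<^sub>l \<in> Aper(q\<^sub>l, x)\<close>, which exists by (i) and (ii), gives infinitely many \<open>j\<close> with
  \<open>\<omega>\<^sub>l + j \<in> Aper(q\<^sub>l, x)\<close> for all \<open>l\<close>; as the alphabet is finite, one pair of distinct letters occurs
  at all levels and \<open>\<omega> + j\<close> lies in the boundary. Any other period structure of \<open>x\<close> is cofinal
  with \<open>q\<close> for divisibility, so nothing depends on the choice.
\<close>

section \<open>Periodic positions, congruences and divisibility\<close>

lemma mem_Per_iff: "j \<in> Per P y \<longleftrightarrow> (\<forall>n. y (j + n * int P) = y j)"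
proof
  assume "j \<in> Per P y"
  then obtain a where a: "\<And>n. y (j + n * int P) = a"
    by (auto simp: Per_def Per_letter_def)
  from a[of 0] a show "\<forall>n. y (j + n * int P) = y j" by simp
qed (auto simp: Per_def Per_letter_def)

lemma mem_Aper_iff: "j \<in> Aper P y \<longleftrightarrow> (\<exists>n. y (j + n * int P) \<noteq> y j)"
  by (simp add: Aper_def mem_Per_iff)

lemma PerD:
  assumes "j \<in> Per P y" "i mod int P = j mod int P"
  shows "y i = y j"
proof -
  from assms(2) obtain n where "i = j + int P * n"
    by (metis mod_eqE)
  with assms(1) show ?thesis by (simp add: mem_Per_iff mult.commute)
qed

lemma Per_mod_cong:
  assumes "i mod int P = j mod int P"
  shows "i \<in> Per P y \<longleftrightarrow> j \<in> Per P y"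
proof -
  have "i \<in> Per P y" if "j \<in> Per P y" "i mod int P = j mod int P" for i j
  proof -
    have "y (i + n * int P) = y i" for n
      using PerD[OF that(1), of "i + n * int P"] PerD[OF that] that(2) by simp
    then show ?thesis by (simp add: mem_Per_iff)
  qed
  with assms show ?thesis by metis
qed

lemma Aper_mod_cong:
  "i mod int P = j mod int P \<Longrightarrow> i \<in> Aper P y \<longleftrightarrow> j \<in> Aper P y"
  using Per_mod_cong by (auto simp: Aper_def)

lemma Per_mono_dvd:
  assumes "P dvd Q"
  shows "Per P y \<subseteq> Per Q y"
proof -
  from assms obtain k where "Q = P * k" by auto
  then have eq: "n * int Q = (n * int k) * int P" for n by simp
  show ?thesis unfolding mem_Per_iff subset_iff eq by blast
qed

lemma Aper_antimono_dvd: "P dvd Q \<Longrightarrow> Aper Q y \<subseteq> Aper P y"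
  using Per_mono_dvd by (auto simp: Aper_def)

lemma dvd_chain:
  fixes p :: "nat \<Rightarrow> nat"
  assumes "\<And>l. p l dvd p (Suc l)" "l \<le> m"
  shows "p l dvd p m"
  using assms(2) by (induction m rule: dec_induct) (auto intro: dvd_trans assms(1))

lemma mod_eq_mono_dvd:
  fixes a b :: int
  assumes "a mod int Q = b mod int Q" "P dvd Q"
  shows "a mod int P = b mod int P"
  using assms by (metis int_dvd_int_iff mod_mod_cancel)

text \<open>The integers \<open>c l\<close> need not be reduced, so a point of the inverse limit is
  encoded by congruences between consecutive levels.\<close>

lemma compatible_mod:
  fixes c :: "nat \<Rightarrow> int"
  assumes "\<And>l. p l dvd p (Suc l)" "\<And>l. c (Suc l) mod int (p l) = c l mod int (p l)" "l \<le> m"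
  shows "c m mod int (p l) = c l mod int (p l)"
  using assms(3)
proof (induction m rule: dec_induct)
  case (step m)
  have "c (Suc m) mod int (p l) = c m mod int (p l)"
    using mod_eq_mono_dvd[OF assms(2) dvd_chain[of p, OF assms(1) step.hyps(1)]] .
  with step.IH show ?case by simp
qed simp

section \<open>Period structures and their mutual cofinality\<close>

lemma period_structure_pos: "period_structure x p \<Longrightarrow> 0 < p l"
  by (cases l) (auto simp: period_structure_def)

lemma period_structure_dvd: "period_structure x p \<Longrightarrow> p l dvd p (Suc l)"
  by (cases l) (auto simp: period_structure_def)

lemma period_structure_cover:
  assumes "period_structure x p"
  obtains m where "L \<le> m" "i \<in> Per (p m) x"
proof -
  from assms have "i \<in> (\<Union>l\<in>{1..}. Per (p l) x)" by (auto simp: period_structure_def)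
  then obtain l where "i \<in> Per (p l) x" by auto
  moreover have "p l dvd p (max l L)"
    using dvd_chain[of p l "max l L"] period_structure_dvd[OF assms] by simp
  ultimately show thesis using that[of "max l L"] Per_mono_dvd by fastforce
qed

text \<open>
  The sequence \<open>gcd (p l) (q m)\<close> stabilises at some \<open>g\<close>. A position of \<open>Per (p l) x\<close> is then
  \<open>g\<close>-periodic, so minimality of \<open>p l\<close> forces \<open>g = p l\<close>.
\<close>

lemma period_structure_dvd_other:
  assumes p: "period_structure x p" and q: "period_structure x q"
  obtains m where "p l dvd q m"
proof (cases "l = 0")
  case True
  with p that show thesis by (auto simp: period_structure_def)
next
  case False
  define P where "P = p l"
  have P: "0 < P" unfolding P_def using period_structure_pos[OF p] .
  have "\<exists>m0. \<forall>m. gcd P (q m) \<le> gcd P (q m0)"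
    using ex_has_greatest_nat[of "\<lambda>_. True" _ "\<lambda>m. gcd P (q m)" "Suc P"] P
    by (auto simp: dvd_imp_le le_imp_less_Suc)
  then obtain m0 where max: "\<And>m. gcd P (q m) \<le> gcd P (q m0)" by blast
  define g where "g = gcd P (q m0)"
  have g: "gcd P (q m) = g" if "m0 \<le> m" for m
  proof -
    have "q m0 dvd q m" using dvd_chain[of q m0 m] period_structure_dvd[OF q] that by blast
    then have "g dvd gcd P (q m)" unfolding g_def by (meson dvd_trans gcd_dvd1 gcd_dvd2 gcd_greatest)
    then have "g \<le> gcd P (q m)" using P by (intro dvd_imp_le) auto
    with max[of m] show ?thesis by (simp add: g_def)
  qed
  have "Per P x \<subseteq> Per g x"
  proof
    fix j assume j: "j \<in> Per P x"
    have "x (j + n * int g) = x j" for n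
    proof -
      \<comment> \<open>By Bezout, \<open>n * g\<close> is a multiple of \<open>P\<close> plus a
        multiple of \<open>q m\<close>, where \<open>m0 \<le> m\<close> gives
        \<open>gcd P (q m) = g\<close>. The first part keeps the letter at \<open>j\<close>; the
        second keeps it because its endpoint is \<open>q m\<close>-periodic.\<close>
      obtain m where m: "m0 \<le> m" "j + n * int g \<in> Per (q m) x"
        using period_structure_cover[OF q] .
      obtain u v where "u * int P + v * int (q m) = int g"
        using bezout_int[of "int P" "int (q m)"] g[OF m(1)] by (metis gcd_int_int_eq)
      then have "n * int g = n * u * int P + n * v * int (q m)"
        by (metis distrib_left mult.assoc)
      then have "(j + n * u * int P) mod int (q m) = (j + n * int g) mod int (q m)"
        by (simp add: add.assoc[symmetric])
      from PerD[OF m(2) this] j show ?thesis by (simp add: mem_Per_iff)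
    qed
    then show "j \<in> Per g x" by (simp add: mem_Per_iff)
  qed
  moreover have "Per g x \<subseteq> Per P x" by (rule Per_mono_dvd) (simp add: g_def)
  moreover have "0 < g" using P by (simp add: g_def)
  moreover have "\<forall>r. 0 < r \<and> r < P \<longrightarrow> Per P x \<noteq> Per r x"
    using p False by (simp add: period_structure_def P_def)
  ultimately have "\<not> g < P" by blast
  moreover have "g \<le> P" using P by (auto simp: g_def intro: dvd_imp_le)
  ultimately have "P dvd q m0" by (metis g_def gcd_dvd2 le_neq_implies_less)
  with that show thesis by (simp add: P_def)
qed

text \<open>Each period of one structure divides a period of the other. Hence the claim on
  \<open>Aper_total\<close> need only be shown for the Oxtoby structure.\<close>

lemma Aper_total_eq:
  assumes p: "period_structure x p" and q: "period_structure x q"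
  shows "Aper_total p y = Aper_total q y"
proof -
  have sub: "(\<Union>l\<in>{1..}. Per (r l) y) \<subseteq> (\<Union>l\<in>{1..}. Per (s l) y)"
    if r: "period_structure x r" and s: "period_structure x s" for r s
  proof
    fix j assume "j \<in> (\<Union>l\<in>{1..}. Per (r l) y)"
    then obtain l where l: "j \<in> Per (r l) y" by auto
    obtain m where "r l dvd s m" using period_structure_dvd_other[OF r s] .
    \<comment> \<open>The union starts at index \<open>1\<close>, while \<open>m\<close> may be
      \<open>0\<close>.\<close>
    then have "r l dvd s (Suc m)" using period_structure_dvd[OF s] dvd_trans by blast
    with l have "j \<in> Per (s (Suc m)) y" using Per_mono_dvd by blast
    then show "j \<in> (\<Union>l\<in>{1..}. Per (s l) y)" by (intro UN_I[of "Suc m"]) auto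
  qed
  from sub[OF p q] sub[OF q p] show ?thesis by (simp add: Aper_total_def)
qed

section \<open>Blocks of a generalised Oxtoby sequence\<close>

text \<open>For a point of the orbit closure with phases \<open>c\<close> this is its total
  aperiodic set; expressed through \<open>c\<close> alone, it also serves points of the
  odometer.\<close>

definition Aper_along :: "(nat \<Rightarrow> nat) \<Rightarrow> (nat \<Rightarrow> int) \<Rightarrow> (int \<Rightarrow> 'a) \<Rightarrow> int set" where
  "Aper_along p c x = {j. \<forall>l. j + c l \<in> Aper (p l) x}"

text \<open>All integers are allowed as indices, whereas the Oxtoby conditions concern only the
  blocks inside one initial period.\<close>

definition Aper_block :: "(nat \<Rightarrow> nat) \<Rightarrow> (int \<Rightarrow> 'a) \<Rightarrow> nat \<Rightarrow> int \<Rightarrow> int set" where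
  "Aper_block p x l k = {j \<in> Aper (p l) x. j div int (p l) = k}"

lemma div_eq_iff_bounds:
  fixes j k P :: int
  assumes "0 < P"
  shows "j div P = k \<longleftrightarrow> k * P \<le> j \<and> j < (k + 1) * P"
proof
  assume "j div P = k"
  then have "j = k * P + j mod P" by (metis div_mult_mod_eq)
  moreover have "0 \<le> j mod P" "j mod P < P" using assms by simp_all
  moreover have "(k + 1) * P = k * P + P" by (simp add: distrib_right)
  ultimately show "k * P \<le> j \<and> j < (k + 1) * P" by linarith
next
  assume "k * P \<le> j \<and> j < (k + 1) * P"
  then show "j div P = k"
    using int_div_pos_eq[of j P k "j - k * P"] by (simp add: algebra_simps)
qed

lemma mem_block_iff:
  assumes "0 < p l"
  shows "j \<in> block p l k \<longleftrightarrow> j div int (p l) = int k"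
  using assms by (auto simp: block_def div_eq_iff_bounds)

lemma oxtoby_period_structure: "generalised_oxtoby_wrt x q \<Longrightarrow> period_structure x q"
  by (simp add: generalised_oxtoby_wrt_def)

text \<open>Translation by a multiple of \<open>q (Suc l)\<close> preserves aperiodicity at both
  levels and brings the common block of \<open>u\<close> and \<open>v\<close> into
  \<open>[0, q (Suc l) - 1]\<close>, where condition (i) applies; \<open>u\<close> rules out the
  empty alternative.\<close>

lemma oxtoby_fill:
  assumes ox: "generalised_oxtoby_wrt x q"
    and u: "u \<in> Aper (q (Suc l)) x" and v: "v \<in> Aper (q l) x"
    and eq: "u div int (q l) = v div int (q l)"
  shows "v \<in> Aper (q (Suc l)) x"
proof -
  note ps = oxtoby_period_structure[OF ox]
  have pos: "0 < q l" "0 < q (Suc l)" using period_structure_pos[OF ps] by auto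
  obtain s where s: "q (Suc l) = q l * s" using period_structure_dvd[OF ps, of l] by auto
  define t where "t = u div int (q (Suc l))"
  define u' where "u' = u - t * int (q (Suc l))"
  define v' where "v' = v - t * int (q (Suc l))"
  have u': "0 \<le> u'" "u' < int (q (Suc l))"
    using pos by (simp_all add: u'_def t_def minus_div_mult_eq_mod)
  have shift: "w - t * int (q (Suc l)) = w + (- t * int s) * int (q l)" for w
    by (simp add: s)
  have eq': "u' div int (q l) = v' div int (q l)"
    unfolding u'_def v'_def shift using pos eq by (simp del: mult_minus_left)
  define k where "k = nat (u' div int (q l))"
  have ku: "u' div int (q l) = int k" using u' pos by (simp add: k_def pos_imp_zdiv_nonneg_iff)
  have "int k * int (q l) \<le> u'" using ku pos by (simp add: div_eq_iff_bounds)
  also have "\<dots> < int s * int (q l)" using u' by (simp add: s mult.commute)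
  finally have "k < q (Suc l) div q l" using pos by (simp add: s mult_less_cancel_right)
  then have alt: "Aper (q (l + 1)) x \<inter> block q l k = {} \<or>
      Aper (q (l + 1)) x \<inter> block q l k = Aper (q l) x \<inter> block q l k"
    using ox by (auto simp: generalised_oxtoby_wrt_def)
  have mods: "u' mod int (q (Suc l)) = u mod int (q (Suc l))"
    "v' mod int (q (Suc l)) = v mod int (q (Suc l))" "v' mod int (q l) = v mod int (q l)"
    using mod_mult_self1[of _ "- t" "int (q (Suc l))"] mod_mult_self1[of v "- t * int s" "int (q l)"]
    by (simp_all add: u'_def v'_def s mult.assoc mult.commute[of "int s"])
  have "u' \<in> Aper (q (Suc l)) x \<inter> block q l k"
    using u Aper_mod_cong[OF mods(1), of x] ku pos by (simp add: mem_block_iff)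
  moreover have "v' \<in> Aper (q l) x \<inter> block q l k"
    using v Aper_mod_cong[OF mods(3), of x] ku eq' pos by (simp add: mem_block_iff)
  ultimately have "v' \<in> Aper (q (Suc l)) x" using alt by auto
  then show ?thesis using Aper_mod_cong[OF mods(2), of x] by blast
qed

text \<open>Condition (ii) gives two unfilled blocks in the initial period; one aperiodic position
  is picked from each.\<close>

lemma oxtoby_two_blocks:
  assumes ox: "generalised_oxtoby_wrt x q"
  obtains u v where "u \<in> Aper (q (Suc l)) x" "v \<in> Aper (q (Suc l)) x"
    "u div int (q l) \<noteq> v div int (q l)"
    "u div int (q (Suc l)) = 0" "v div int (q (Suc l)) = 0"
proof -
  note ps = oxtoby_period_structure[OF ox]
  have pos: "0 < q l" "0 < q (Suc l)" using period_structure_pos[OF ps] by auto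
  obtain s where s: "q (Suc l) = q l * s" using period_structure_dvd[OF ps, of l] by auto
  define K where "K = {k. k < q (Suc l) div q l \<and> Aper (q (Suc l)) x \<inter> block q l k \<noteq> {}}"
  have "2 \<le> card K" using ox by (simp add: generalised_oxtoby_wrt_def K_def)
  moreover have "finite K" by (simp add: K_def)
  ultimately obtain k k' where K: "k \<in> K" "k' \<in> K" "k \<noteq> k'"
    using card_le_Suc0_iff_eq[of K] by auto
  have "\<exists>u \<in> Aper (q (Suc l)) x. u div int (q l) = int k \<and> u div int (q (Suc l)) = 0"
    if k: "k \<in> K" for k
  proof -
    obtain u where u: "u \<in> Aper (q (Suc l)) x" "u \<in> block q l k" using k by (auto simp: K_def)
    from k have "k < s" using pos by (simp add: K_def s)
    moreover have "u div int (q (Suc l)) = u div int (q l) div int s"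
      by (simp add: s zdiv_zmult2_eq)
    ultimately show ?thesis using u pos by (auto simp: mem_block_iff)
  qed
  with K that show thesis by (metis of_nat_eq_iff)
qed

lemma finite_Aper_block: "0 < p l \<Longrightarrow> finite (Aper_block p x l k)"
  by (rule finite_subset[of _ "{k * int (p l)..(k + 1) * int (p l)}"])
     (auto simp: Aper_block_def div_eq_iff_bounds)

lemma card_Aper_block_shift:
  assumes "0 < p l"
  shows "card (Aper_block p x l k) = card (Aper_block p x l 0)"
proof -
  have "bij_betw (\<lambda>j. j + k * int (p l)) (Aper_block p x l 0) (Aper_block p x l k)"
  proof (rule bij_betw_byWitness[where f' = "\<lambda>j. j - k * int (p l)"])
    have cong: "i + n * int (p l) \<in> Aper (p l) x \<longleftrightarrow> i \<in> Aper (p l) x" for i n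
      by (rule Aper_mod_cong) simp
    show "(\<lambda>j. j + k * int (p l)) ` Aper_block p x l 0 \<subseteq> Aper_block p x l k"
      using assms cong by (auto simp: Aper_block_def)
    show "(\<lambda>j. j - k * int (p l)) ` Aper_block p x l k \<subseteq> Aper_block p x l 0"
      using assms cong[of _ "- k"] div_mult_self1[of "int (p l)" _ "- k"]
      by (auto simp: Aper_block_def)
  qed auto
  then show ?thesis using bij_betw_same_card by metis
qed

text \<open>By induction: block \<open>0\<close> of level \<open>Suc l\<close> contains two distinct
  blocks of level \<open>l\<close> with a surviving position. By \<open>oxtoby_fill\<close> each
  keeps all its aperiodic positions, so the counts add up; translation gives every
  \<open>k\<close>.\<close>

lemma oxtoby_card_Aper_block:
  assumes ox: "generalised_oxtoby_wrt x q"
  shows "2 ^ l \<le> card (Aper_block q x l k)"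
proof (induction l arbitrary: k)
  case 0
  note ps = oxtoby_period_structure[OF ox]
  obtain u where "u \<in> Aper (q (Suc 0)) x" using oxtoby_two_blocks[OF ox] by metis
  then have "u \<in> Aper_block q x 0 (u div int (q 0))"
    using Aper_antimono_dvd period_structure_dvd[OF ps, of 0] by (fastforce simp: Aper_block_def)
  then have "0 < card (Aper_block q x 0 (u div int (q 0)))"
    using finite_Aper_block period_structure_pos[OF ps] by (metis card_gt_0_iff empty_iff)
  then show ?case
    using card_Aper_block_shift[of q 0] period_structure_pos[OF ps] by (metis One_nat_def Suc_leI power_0)
next
  case (Suc l)
  note ps = oxtoby_period_structure[OF ox]
  have pos: "0 < q l" "0 < q (Suc l)" using period_structure_pos[OF ps] by auto
  obtain s where s: "q (Suc l) = q l * s" using period_structure_dvd[OF ps, of l] by auto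
  obtain u v where uv: "u \<in> Aper (q (Suc l)) x" "v \<in> Aper (q (Suc l)) x"
    "u div int (q l) \<noteq> v div int (q l)"
    "u div int (q (Suc l)) = 0" "v div int (q (Suc l)) = 0"
    using oxtoby_two_blocks[OF ox] .
  have sub: "Aper_block q x l (w div int (q l)) \<subseteq> Aper_block q x (Suc l) 0"
    if "w \<in> Aper (q (Suc l)) x" "w div int (q (Suc l)) = 0" for w
    using that oxtoby_fill[OF ox that(1)] by (auto simp: Aper_block_def s zdiv_zmult2_eq)
  have "2 ^ Suc l \<le> card (Aper_block q x l (u div int (q l))) + card (Aper_block q x l (v div int (q l)))"
    using Suc.IH[of "u div int (q l)"] Suc.IH[of "v div int (q l)"] by simp
  also have "\<dots> = card (Aper_block q x l (u div int (q l)) \<union> Aper_block q x l (v div int (q l)))"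
    using uv(3) by (intro card_Un_disjoint[symmetric] finite_Aper_block pos) (auto simp: Aper_block_def)
  also have "\<dots> \<le> card (Aper_block q x (Suc l) 0)"
    using sub uv by (intro card_mono finite_Aper_block pos) auto
  finally show ?case using card_Aper_block_shift[of q "Suc l" x k] pos(2) by simp
qed

text \<open>A block has only \<open>q l\<close> elements. The growth makes the periods unbounded, so
  that rotations by different integers are distinct.\<close>

lemma oxtoby_period_ge:
  assumes ox: "generalised_oxtoby_wrt x q"
  shows "2 ^ l \<le> q l"
proof -
  have pos: "0 < q l" using period_structure_pos[OF oxtoby_period_structure[OF ox]] .
  have "2 ^ l \<le> card (Aper_block q x l 0)" using oxtoby_card_Aper_block[OF ox] .
  also have "\<dots> \<le> card {0..<int (q l)}"
    using pos by (intro card_mono) (auto simp: Aper_block_def div_eq_iff_bounds)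
  finally show ?thesis by simp
qed

text \<open>
  The block of level \<open>l\<close> around a surviving position is never filled at a later level, so all of
  its aperiodic positions survive.
\<close>

lemma oxtoby_Aper_along_infinite:
  assumes ox: "generalised_oxtoby_wrt x q"
    and c: "\<And>l. c (Suc l) mod int (q l) = c l mod int (q l)"
    and ne: "Aper_along q c x \<noteq> {}"
  shows "infinite (Aper_along q c x)"
proof
  assume fin: "finite (Aper_along q c x)"
  note ps = oxtoby_period_structure[OF ox]
  from ne obtain j where j: "\<And>l. j + c l \<in> Aper (q l) x" by (auto simp: Aper_along_def)
  have ge: "2 ^ l \<le> card (Aper_along q c x)" for l
  proof -
    \<comment> \<open>\<open>k\<close> is the block of \<open>x\<close> in which \<open>j\<close>
      lies for the phase \<open>c l\<close>. Its aperiodic positions, moved back by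
      \<open>c l\<close>, will survive at every level.\<close>
    define k where "k = (j + c l) div int (q l)"
    have "(\<lambda>i. i - c l) ` Aper_block q x l k \<subseteq> Aper_along q c x"
    proof clarify
      fix u assume "u \<in> Aper_block q x l k"
      then have u: "u \<in> Aper (q l) x" "u div int (q l) = k" by (auto simp: Aper_block_def)
      define i where "i = u - c l"
      have up: "i + c m \<in> Aper (q m) x \<and> (i + c m) div int (q m) = (j + c m) div int (q m)"
        if "l \<le> m" for m
        using that
      proof (induction m rule: dec_induct)
        case base
        show ?case using u by (simp add: i_def k_def)
      next
        case (step m)
        have pos: "0 < q m" using period_structure_pos[OF ps] .
        obtain s where s: "q (Suc m) = q m * s" using period_structure_dvd[OF ps, of m] by auto
        \<comment> \<open>Passing from \<open>c m\<close> to \<open>c (Suc m)\<close> shifts every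
          quotient by the same \<open>n\<close>, so \<open>i\<close> and \<open>j\<close> stay in a
          common block, which \<open>j\<close> shows to be unfilled.\<close>
        obtain n where n: "c (Suc m) = c m + int (q m) * n" using c[of m] by (metis mod_eqE)
        have "(w + c (Suc m)) div int (q m) = (w + c m) div int (q m) + n" for w
          using pos by (simp add: n add.assoc[symmetric])
        then have eq: "(i + c (Suc m)) div int (q m) = (j + c (Suc m)) div int (q m)"
          using step.IH by simp
        have "(i + c (Suc m)) mod int (q m) = (i + c m) mod int (q m)"
          using mod_add_cong[OF refl c] .
        then have "i + c (Suc m) \<in> Aper (q m) x" using step.IH Aper_mod_cong by blast
        with eq j oxtoby_fill[OF ox, of "j + c (Suc m)"] have "i + c (Suc m) \<in> Aper (q (Suc m)) x"
          by simp
        moreover have "(i + c (Suc m)) div int (q (Suc m)) = (j + c (Suc m)) div int (q (Suc m))"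
          using eq by (simp add: s zdiv_zmult2_eq)
        ultimately show ?case by simp
      qed
      have "i + c m \<in> Aper (q m) x" for m
      proof (cases "l \<le> m")
        case True
        then show ?thesis using up by blast
      next
        case False
        then have "m \<le> l" by simp
        have "q m dvd q l" using dvd_chain[of q, OF period_structure_dvd[OF ps] \<open>m \<le> l\<close>] .
        then have "i + c l \<in> Aper (q m) x" using u Aper_antimono_dvd by (fastforce simp: i_def)
        moreover have "(i + c l) mod int (q m) = (i + c m) mod int (q m)"
          using mod_add_cong[OF refl compatible_mod[of q c, OF period_structure_dvd[OF ps] c \<open>m \<le> l\<close>]] .
        ultimately show ?thesis using Aper_mod_cong by blast
      qed
      then show "u - c l \<in> Aper_along q c x" by (simp add: Aper_along_def i_def)
    qed
    then have "card ((\<lambda>i. i - c l) ` Aper_block q x l k) \<le> card (Aper_along q c x)"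
      using fin by (intro card_mono)
    moreover have "card ((\<lambda>i. i - c l) ` Aper_block q x l k) = card (Aper_block q x l k)"
      by (rule card_image) (simp add: inj_on_def)
    ultimately show ?thesis using oxtoby_card_Aper_block[OF ox, of l k] by simp
  qed
  \<comment> \<open>At the level equal to the supposed cardinality, \<open>2 ^ l\<close> already
    exceeds it.\<close>
  from ge[of "card (Aper_along q c x)"] show False
    using less_exp[of "card (Aper_along q c x)"] by linarith
qed

section \<open>Phases of points of the orbit closure\<close>

lemma orbit_closure_approx:
  assumes "y \<in> orbit_closure x" "finite K"
  obtains n where "\<And>j. j \<in> K \<Longrightarrow> x (j + n) = y j"
proof -
  \<comment> \<open>The cylinder of words that agree with \<open>y\<close> on
    \<open>K\<close>.\<close>
  define T where "T = (\<Pi>\<^sub>E j\<in>UNIV. if j \<in> K then {y j} else UNIV)"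
  have "openin word_topology T"
    unfolding word_topology_def T_def using assms(2)
    by (intro product_topology_basis) (auto elim: rev_finite_subset)
  moreover have "y \<in> T" by (auto simp: T_def)
  ultimately obtain n where "shift n x \<in> T"
    using assms(1) by (auto simp: orbit_closure_def in_closure_of)
  then have "x (j + n) = y j" if "j \<in> K" for j
    using that by (auto simp: T_def shift_def PiE_iff dest: spec[of _ j])
  with that show thesis by blast
qed

text \<open>Compactness: as there are finitely many residues modulo \<open>p l\<close>, one class
  contains suitable shifts for every finite window. Such a class refines to one at the next level,
  and dependent choice gives a coherent sequence.\<close>

lemma orbit_closure_phase:
  assumes y: "y \<in> orbit_closure x" and pos: "\<And>l. 0 < p l" and dvd: "\<And>l. p l dvd p (Suc l)"
  obtains c where "\<And>l. c (Suc l) mod int (p l) = c l mod int (p l)"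
    and "\<And>l K. finite K \<Longrightarrow> \<exists>n. n mod int (p l) = c l mod int (p l) \<and> (\<forall>j\<in>K. x (j + n) = y j)"
proof -
  define good where "good l c \<longleftrightarrow>
    (\<forall>K. finite K \<longrightarrow> (\<exists>n. n mod int (p l) = c mod int (p l) \<and> (\<forall>j\<in>K. x (j + n) = y j)))" for l c
  \<comment> \<open>\<open>Q\<close> is trivial for the first choice and restricts to residues over
    \<open>c\<close> for the lift.\<close>
  have pigeon: "\<exists>c. Q c \<and> good l c"
    if ex: "\<And>K. finite K \<Longrightarrow> \<exists>n. Q (n mod int (p l)) \<and> (\<forall>j\<in>K. x (j + n) = y j)" for Q l
  proof (rule ccontr)
    assume "\<not> ?thesis"
    then have "\<forall>c. \<exists>K. Q c \<longrightarrow> finite K \<and>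
        (\<forall>n. n mod int (p l) = c mod int (p l) \<longrightarrow> \<not> (\<forall>j\<in>K. x (j + n) = y j))"
      by (auto simp: good_def)
    then obtain K where K: "\<And>c. Q c \<Longrightarrow> finite (K c) \<and>
        (\<forall>n. n mod int (p l) = c mod int (p l) \<longrightarrow> \<not> (\<forall>j\<in>K c. x (j + n) = y j))"
      by metis
    \<comment> \<open>A shift that works on the union of the bad windows contradicts the failure of
      its own class.\<close>
    have "finite (\<Union>c\<in>{c \<in> {0..<int (p l)}. Q c}. K c)" 
      by (rule finite_UN_I, rule finite_subset[of _ "{0..<int (p l)}"]) (use K in auto)
    from ex[OF this] obtain n where n: "Q (n mod int (p l))"
      "\<forall>j\<in>(\<Union>c\<in>{c \<in> {0..<int (p l)}. Q c}. K c). x (j + n) = y j" by blast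
    have "n mod int (p l) \<in> {c \<in> {0..<int (p l)}. Q c}" using pos[of l] n(1) by simp
    with n(2) have "\<forall>j\<in>K (n mod int (p l)). x (j + n) = y j" by blast
    with K[OF n(1)] show False by (metis mod_mod_trivial)
  qed
  have "\<exists>c. good 0 c"
    using pigeon[of "\<lambda>_. True" 0] orbit_closure_approx[OF y] by metis
  moreover have "\<exists>c'. good (Suc l) c' \<and> c' mod int (p l) = c mod int (p l)" if "good l c" for l c
  proof -
    have "n mod int (p (Suc l)) mod int (p l) = n mod int (p l)" for n
      using mod_mod_cancel[of "int (p l)" "int (p (Suc l))" n] dvd[of l] by simp
    then show ?thesis
      using pigeon[of "\<lambda>c'. c' mod int (p l) = c mod int (p l)" "Suc l"] that
      by (auto simp: good_def)
  qed
  ultimately obtain c where "\<forall>l. good l (c l) \<and> c (Suc l) mod int (p l) = c l mod int (p l)"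
    using dependent_nat_choice[of good "\<lambda>l c c'. c' mod int (p l) = c mod int (p l)"] by blast
  then show thesis using that[of c] by (auto simp: good_def)
qed

text \<open>Where \<open>x\<close> is periodic at level \<open>m\<close>, its letters reappear in
  \<open>y\<close> displaced by \<open>c m\<close>. Since every position of \<open>x\<close> is
  periodic at some level, periods of \<open>y\<close> can be read back in \<open>x\<close>.\<close>

lemma Aper_phase:
  assumes ps: "period_structure x p"
    and c: "\<And>l. c (Suc l) mod int (p l) = c l mod int (p l)"
    and approx: "\<And>l K. finite K \<Longrightarrow>
      \<exists>n. n mod int (p l) = c l mod int (p l) \<and> (\<forall>j\<in>K. x (j + n) = y j)"
  shows "j \<in> Aper (p l) y \<longleftrightarrow> j + c l \<in> Aper (p l) x"
proof -
  have val: "y t = x (t + c m)" if "t + c m \<in> Per (p m) x" for t m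
  proof -
    obtain n where n: "n mod int (p m) = c m mod int (p m)" "x (t + n) = y t"
      using approx[of "{t}" m] by auto
    have "(t + n) mod int (p m) = (t + c m) mod int (p m)" using mod_add_cong[OF refl n(1)] .
    from PerD[OF that this] n(2) show ?thesis by simp
  qed
  have "j \<in> Per (p l) y" if "j + c l \<in> Per (p l) x"
  proof -
    have "y (j + n * int (p l)) = y j" for n
    proof -
      have "(j + n * int (p l) + c l) mod int (p l) = (j + c l) mod int (p l)"
        by (metis add.assoc add.commute mod_mult_self1)
      then have "j + n * int (p l) + c l \<in> Per (p l) x" using that Per_mod_cong by blast
      moreover have "x (j + n * int (p l) + c l) = x (j + c l)"
        using that by (metis PerD \<open>(j + n * int (p l) + c l) mod int (p l) = (j + c l) mod int (p l)\<close>)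
      ultimately show ?thesis using val that by simp
    qed
    then show ?thesis by (simp add: mem_Per_iff)
  qed
  moreover have "j + c l \<in> Per (p l) x" if j: "j \<in> Per (p l) y"
  proof -
    have "x (j + c l + n * int (p l)) = y j" for n
    proof -
      obtain m where m: "l \<le> m" "j + c l + n * int (p l) \<in> Per (p m) x"
        using period_structure_cover[OF ps] .
      \<comment> \<open>The position of \<open>y\<close> that carries the given letter of
        \<open>x\<close> under the phase \<open>c m\<close>; it is congruent to \<open>j\<close>
        modulo \<open>p l\<close>.\<close>
      define t where "t = j + c l + n * int (p l) - c m"
      have "c m mod int (p l) = c l mod int (p l)"
        using compatible_mod[of p c, OF period_structure_dvd[OF ps] c m(1)] .
      then have "t mod int (p l) = (j + c l + n * int (p l) - c l) mod int (p l)"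
        unfolding t_def by (intro mod_diff_cong) auto
      then have "t mod int (p l) = j mod int (p l)" by simp
      from PerD[OF j this] val[of t m] m(2) show ?thesis by (simp add: t_def)
    qed
    from this this[of 0] show ?thesis by (simp add: mem_Per_iff)
  qed
  ultimately show ?thesis by (auto simp: Aper_def)
qed

text \<open>Level \<open>0\<close> can join the range of levels because \<open>p 0\<close> divides
  \<open>p 1\<close> and aperiodic sets decrease along divisibility.\<close>

lemma Aper_total_conv:
  assumes "period_structure x p"
  shows "Aper_total p y = {j. \<forall>l. j \<in> Aper (p l) y}"
proof -
  have "j \<in> Aper (p 0) y" if "j \<in> Aper (p (Suc 0)) y" for j
    using that Aper_antimono_dvd[OF period_structure_dvd[OF assms, of 0]] by blast
  then have "(\<forall>l. j \<in> Aper (p l) y) \<longleftrightarrow> (\<forall>l\<ge>1. j \<in> Aper (p l) y)" for j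
    by (metis One_nat_def not_less_eq_eq le0 le_antisym order_refl not0_implies_Suc Suc_le_mono)
  then show ?thesis by (auto simp: Aper_total_def Aper_def)
qed

lemma oxtoby_Aper_total:
  assumes ox: "generalised_oxtoby_wrt x q" and y: "y \<in> orbit_closure x"
  shows "Aper_total q y = {} \<or> infinite (Aper_total q y)"
proof -
  note ps = oxtoby_period_structure[OF ox]
  obtain c where c: "\<And>l. c (Suc l) mod int (q l) = c l mod int (q l)"
    and approx: "\<And>l K. finite K \<Longrightarrow>
      \<exists>n. n mod int (q l) = c l mod int (q l) \<and> (\<forall>j\<in>K. x (j + n) = y j)"
    using orbit_closure_phase[OF y, of q] period_structure_pos[OF ps] period_structure_dvd[OF ps]
    by metis
  have "Aper_total q y = Aper_along q c x"
    using Aper_phase[of x q c y, OF ps c approx] by (simp add: Aper_total_conv[OF ps] Aper_along_def)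
  then show ?thesis using oxtoby_Aper_along_infinite[of x q c, OF ox c] by metis
qed

section \<open>Boundary points on an orbit of the odometer\<close>

text \<open>A residue aperiodic at level \<open>l\<close> is moved into a level-\<open>l\<close>
  block that is unfilled at level \<open>Suc l\<close>, where \<open>oxtoby_fill\<close> keeps it
  aperiodic. Iterating this gives \<open>c\<close> with \<open>0\<close> aperiodic along it.\<close>

lemma oxtoby_phase_exists:
  assumes ox: "generalised_oxtoby_wrt x q"
  obtains c where "\<And>l. c (Suc l) mod int (q l) = c l mod int (q l)"
    and "Aper_along q c x \<noteq> {}"
proof -
  note ps = oxtoby_period_structure[OF ox]
  have pos: "0 < q l" for l using period_structure_pos[OF ps] .
  have "\<exists>c'. c' \<in> Aper (q (Suc l)) x \<and> c' mod int (q l) = c mod int (q l)"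
    if c: "c \<in> Aper (q l) x" for l c
  proof -
    obtain u where u: "u \<in> Aper (q (Suc l)) x" using oxtoby_two_blocks[OF ox] by metis
    define c' where "c' = (u div int (q l)) * int (q l) + c mod int (q l)"
    have mod: "c' mod int (q l) = c mod int (q l)" by (simp add: c'_def)
    have "u div int (q l) = c' div int (q l)" using pos[of l] by (simp add: c'_def)
    with oxtoby_fill[OF ox u] Aper_mod_cong[OF mod] c mod show ?thesis by blast
  qed
  moreover have "\<exists>c. c \<in> Aper (q 0) x"
    using oxtoby_two_blocks[OF ox, of 0] Aper_antimono_dvd[OF period_structure_dvd[OF ps, of 0]]
    by blast
  ultimately obtain c where "\<And>l. c l \<in> Aper (q l) x \<and> c (Suc l) mod int (q l) = c l mod int (q l)"
    using dependent_nat_choice[of "\<lambda>l c. c \<in> Aper (q l) x" "\<lambda>l c c'. c' mod int (q l) = c mod int (q l)"]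
    by blast
  moreover from this have "0 \<in> Aper_along q c x" by (simp add: Aper_along_def)
  ultimately show thesis using that[of c] by blast
qed

text \<open>A basic neighbourhood of \<open>\<omega>\<close> restricts finitely many coordinates. By
  coherence a coordinate \<open>L\<close> bounding them determines them all, so one \<open>i\<close>
  per level suffices.\<close>

lemma mem_graph_closure:
  assumes ps: "period_structure x p" and \<omega>: "\<omega> \<in> odometer p"
    and ex: "\<And>l. \<exists>i. x i = a \<and> i mod int (p l) = \<omega> l"
  shows "(\<omega>, a) \<in> graph_closure p x"
proof -
  have pos: "0 < p l" for l using period_structure_pos[OF ps] .
  have \<omega>E: "\<omega> l \<in> {0..<int (p l)}" "\<omega> (Suc l) mod int (p l) = \<omega> l mod int (p l)" for l
    using \<omega> pos[of l] by (auto simp: odometer_def)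
  have eta: "eta p i \<in> odometer p" for i
    using pos dvd_imp_mod_0 mod_mod_cancel[of "int (p l)" "int (p (Suc l))" i for l]
      period_structure_dvd[OF ps]
    by (auto simp: eta_def odometer_def)
  have "\<exists>i. (eta p i, x i) \<in> T"
    if T: "(\<omega>, a) \<in> T" "openin (prod_topology (odometer_topology p) (discrete_topology UNIV)) T" for T
  proof -
    obtain U V where UV: "openin (odometer_topology p) U" "\<omega> \<in> U" "a \<in> V" "U \<times> V \<subseteq> T"
      using T(1) T(2)[unfolded openin_prod_topology_alt] by blast
    then obtain W where
      W: "openin (product_topology (\<lambda>l. discrete_topology {0..<int (p l)}) UNIV) W" "U = W \<inter> odometer p"
      by (auto simp: odometer_topology_def openin_subtopology)
    from W UV obtain X where X: "\<omega> \<in> (\<Pi>\<^sub>E l\<in>UNIV. X l)" "finite {l. X l \<noteq> {0..<int (p l)}}"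
      "(\<Pi>\<^sub>E l\<in>UNIV. X l) \<subseteq> W"
      using product_topology_open_contains_basis[OF W(1), of \<omega>] by auto
    obtain L where L: "\<And>l. X l \<noteq> {0..<int (p l)} \<Longrightarrow> l \<le> L"
      using X(2) finite_nat_set_iff_bounded_le by auto
    obtain i where i: "x i = a" "i mod int (p L) = \<omega> L" using ex by blast
    have "eta p i l \<in> X l" for l
    proof (cases "l \<le> L")
      case True
      have "i mod int (p L) = \<omega> L mod int (p L)" using i \<omega>E(1)[of L] by simp
      then have "i mod int (p l) = \<omega> L mod int (p l)"
        by (rule mod_eq_mono_dvd) (rule dvd_chain[of p, OF period_structure_dvd[OF ps] True])
      also have "\<dots> = \<omega> l mod int (p l)"
        using compatible_mod[of p \<omega>, OF period_structure_dvd[OF ps] \<omega>E(2) True] .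
      finally have "eta p i l = \<omega> l" using \<omega>E(1)[of l] by (simp add: eta_def)
      then show ?thesis using X(1) by (auto simp: PiE_iff)
    next
      case False
      then have "X l = {0..<int (p l)}" using L by blast
      then show ?thesis using pos[of l] by (simp add: eta_def)
    qed
    then have "eta p i \<in> U" using X(3) W(2) eta by (auto simp: PiE_iff)
    with UV i show ?thesis by blast
  qed
  moreover have "\<omega> \<in> topspace (odometer_topology p)"
    using \<omega> \<omega>E(1) by (auto simp: odometer_topology_def PiE_iff)
  ultimately show ?thesis by (auto simp: graph_closure_def in_closure_of)
qed

lemma rotation_in_odometer:
  assumes ps: "period_structure x p" and \<omega>: "\<omega> \<in> odometer p"
  shows "rotation p n \<omega> \<in> odometer p"
proof -
  have "(\<omega> (Suc l) + n) mod int (p (Suc l)) mod int (p l) = (\<omega> l + n) mod int (p l)" for l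
  proof -
    have "(\<omega> (Suc l) + n) mod int (p (Suc l)) mod int (p l) = (\<omega> (Suc l) + n) mod int (p l)"
      using period_structure_dvd[OF ps, of l] by (simp add: mod_mod_cancel)
    also have "\<dots> = (\<omega> (Suc l) mod int (p l) + n) mod int (p l)" by (simp add: mod_simps)
    also have "\<omega> (Suc l) mod int (p l) = \<omega> l" using \<omega> by (simp add: odometer_def)
    finally show ?thesis .
  qed
  then show ?thesis using period_structure_pos[OF ps] by (simp add: rotation_def odometer_def)
qed

lemma rotation_in_boundary_set:
  fixes x :: "int \<Rightarrow> 'a::finite"
  assumes ps: "period_structure x p" and \<omega>: "\<omega> \<in> odometer p" and j: "j \<in> Aper_along p \<omega> x"
  shows "rotation p j \<omega> \<in> boundary_set p x"
proof -
  define hit where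
    "hit l a \<longleftrightarrow> (\<exists>i. x i = a \<and> i mod int (p l) = (j + \<omega> l) mod int (p l))" for l a
  have compat: "(j + \<omega> m) mod int (p l) = (j + \<omega> l) mod int (p l)" if "l \<le> m" for l m
  proof -
    have "\<omega> (Suc l) mod int (p l) = \<omega> l mod int (p l)" for l
      using \<omega> by (auto simp: odometer_def)
    from mod_add_cong[OF refl compatible_mod[of p \<omega>, OF period_structure_dvd[OF ps] this that]]
    show ?thesis .
  qed
  \<comment> \<open>Residue classes shrink as the level grows, so a hit is inherited by lower
    levels.\<close>
  have anti: "hit l a" if "hit m a" "l \<le> m" for l m a
  proof -
    from that obtain i where i: "x i = a" "i mod int (p m) = (j + \<omega> m) mod int (p m)"
      by (auto simp: hit_def)
    have "i mod int (p l) = (j + \<omega> m) mod int (p l)"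
      using mod_eq_mono_dvd[OF i(2) dvd_chain[of p, OF period_structure_dvd[OF ps] that(2)]] .
    with i compat[OF that(2)] show ?thesis by (auto simp: hit_def)
  qed
  \<comment> \<open>The pair of letters may vary with the level. There are finitely many pairs, so
    one recurs at infinitely many levels and, by \<open>anti\<close>, occurs at all.\<close>
  have "\<exists>ab\<in>{(a, b). a \<noteq> b}. hit l (fst ab) \<and> hit l (snd ab)" for l
  proof -
    from j have "j + \<omega> l \<in> Aper (p l) x" by (simp add: Aper_along_def)
    then obtain n where n: "x (j + \<omega> l + n * int (p l)) \<noteq> x (j + \<omega> l)"
      by (auto simp: mem_Aper_iff)
    have "hit l (x (j + \<omega> l + n * int (p l)))" "hit l (x (j + \<omega> l))"
      unfolding hit_def
      by (intro exI[of _ "j + \<omega> l + n * int (p l)"], simp) (intro exI[of _ "j + \<omega> l"], simp)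
    with n show ?thesis by force
  qed
  then obtain ab where ab: "fst ab \<noteq> snd ab" "infinite {l. hit l (fst ab) \<and> hit l (snd ab)}"
    using pigeonhole_infinite_rel[of UNIV "{(a, b). a \<noteq> b}" "\<lambda>l ab. hit l (fst ab) \<and> hit l (snd ab)"]
    by (auto simp: case_prod_unfold)
  have "hit l (fst ab) \<and> hit l (snd ab)" for l
    using ab(2) anti[of _ _ l] by (metis (mono_tags, lifting) infinite_nat_iff_unbounded_le mem_Collect_eq)
  then have "(rotation p j \<omega>, fst ab) \<in> graph_closure p x" "(rotation p j \<omega>, snd ab) \<in> graph_closure p x"
    by (intro mem_graph_closure[OF ps rotation_in_odometer[OF ps \<omega>]];
        simp add: hit_def rotation_def add.commute)+
  with ab(1) rotation_in_odometer[OF ps \<omega>] show ?thesis by (auto simp: boundary_set_def)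
qed

text \<open>Equal rotations by \<open>m\<close> and \<open>n\<close> make every \<open>p l\<close>
  divide \<open>m - n\<close>, and some \<open>p l\<close> exceeds the absolute value of
  \<open>m - n\<close>.\<close>

lemma inj_rotation:
  assumes unb: "\<And>N. \<exists>l. N < p l"
  shows "inj (\<lambda>n. rotation p n \<omega>)"
proof (rule injI)
  fix m n assume eq: "rotation p m \<omega> = rotation p n \<omega>"
  obtain l where l: "nat \<bar>m - n\<bar> < p l" using unb by blast
  from eq have "(\<omega> l + m) mod int (p l) = (\<omega> l + n) mod int (p l)"
    by (auto simp: rotation_def fun_eq_iff)
  then have "int (p l) dvd m - n" by (simp add: mod_eq_dvd_iff)
  with l show "m = n" using dvd_imp_le_int[of "m - n" "int (p l)"] by linarith
qed

text \<open>As \<open>p l\<close> divides some \<open>q (m l)\<close>, the phase along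
  \<open>q\<close> can be reduced modulo \<open>p l\<close>, and aperiodicity passes to the
  divisor.\<close>

lemma odometer_phase_transfer:
  assumes p: "period_structure x p" and q: "period_structure x q"
    and c: "\<And>l. c (Suc l) mod int (q l) = c l mod int (q l)"
  obtains \<omega> where "\<omega> \<in> odometer p" "Aper_along q c x \<subseteq> Aper_along p \<omega> x"
proof -
  have "\<exists>m. p l dvd q m" for l using period_structure_dvd_other[OF p q, of l] by blast
  then obtain m where m: "\<And>l. p l dvd q (m l)" by metis
  define \<omega> where "\<omega> l = c (m l) mod int (p l)" for l
  \<comment> \<open>The residue is independent of the chosen level of \<open>q\<close>: two levels
    are compared at their maximum. This makes \<open>\<omega>\<close> coherent.\<close>
  have c_mod: "c k mod int (p l) = \<omega> l" if "p l dvd q k" for k l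
  proof -
    have eq: "c (max k (m l)) mod int (q k) = c k mod int (q k)"
      "c (max k (m l)) mod int (q (m l)) = c (m l) mod int (q (m l))"
      by (rule compatible_mod[of q c, OF period_structure_dvd[OF q] c]; simp)+
    show ?thesis unfolding \<omega>_def using mod_eq_mono_dvd[OF eq(1) that] mod_eq_mono_dvd[OF eq(2) m] by metis
  qed
  have "\<omega> (Suc l) mod int (p l) = \<omega> l" for l
  proof -
    have "\<omega> (Suc l) mod int (p l) = c (m (Suc l)) mod int (p l)"
      using period_structure_dvd[OF p, of l] by (simp add: \<omega>_def mod_mod_cancel)
    also have "\<dots> = \<omega> l" using c_mod dvd_trans[OF period_structure_dvd[OF p, of l] m] .
    finally show ?thesis .
  qed
  then have "\<omega> \<in> odometer p" using period_structure_pos[OF p] by (simp add: odometer_def \<omega>_def)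
  moreover have "j + \<omega> l \<in> Aper (p l) x" if j: "j \<in> Aper_along q c x" for j l
  proof -
    have "j + c (m l) \<in> Aper (p l) x"
      using j Aper_antimono_dvd[OF m] by (fastforce simp: Aper_along_def)
    moreover have "(j + c (m l)) mod int (p l) = (j + \<omega> l) mod int (p l)"
      by (simp add: \<omega>_def mod_simps)
    ultimately show ?thesis using Aper_mod_cong by blast
  qed
  then have "Aper_along q c x \<subseteq> Aper_along p \<omega> x" unfolding Aper_along_def[of p] by blast
  ultimately show thesis using that by blast
qed

text \<open>Rotations of \<open>\<omega>\<close> by the infinitely many elements of
  \<open>Aper_along p \<omega> x\<close> lie in the boundary, and unbounded periods make them
  distinct.\<close>

lemma oxtoby_infinite_orbit_boundary:
  fixes x :: "int \<Rightarrow> 'a::finite"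
  assumes ox: "generalised_oxtoby_wrt x q" and p: "period_structure x p"
  obtains \<omega> where "\<omega> \<in> odometer p" "infinite (odometer_orbit p \<omega> \<inter> boundary_set p x)"
proof -
  note q = oxtoby_period_structure[OF ox]
  obtain c where c: "\<And>l. c (Suc l) mod int (q l) = c l mod int (q l)"
    and ne: "Aper_along q c x \<noteq> {}"
    using oxtoby_phase_exists[OF ox] by metis
  obtain \<omega> where \<omega>: "\<omega> \<in> odometer p" "Aper_along q c x \<subseteq> Aper_along p \<omega> x"
    using odometer_phase_transfer[of x p q c, OF p q c] by metis
  \<comment> \<open>Each \<open>q N\<close> divides some \<open>p l\<close>, so the growth of
    \<open>q\<close> carries over to \<open>p\<close>.\<close>
  have "\<exists>l. N < p l" for N
  proof -
    obtain l where "q N dvd p l" using period_structure_dvd_other[OF q p] .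
    then have "q N \<le> p l" using period_structure_pos[OF p] by (simp add: dvd_imp_le)
    then show ?thesis using oxtoby_period_ge[OF ox, of N] less_exp[of N] by (meson le_trans not_le)
  qed
  then have "inj (\<lambda>n. rotation p n \<omega>)" by (rule inj_rotation)
  then have "infinite ((\<lambda>n. rotation p n \<omega>) ` Aper_along p \<omega> x)"
    using oxtoby_Aper_along_infinite[of x q c, OF ox c ne] \<omega>(2)
    by (auto dest!: finite_imageD intro: inj_on_subset finite_subset)
  moreover have "(\<lambda>n. rotation p n \<omega>) ` Aper_along p \<omega> x \<subseteq> odometer_orbit p \<omega> \<inter> boundary_set p x"
    using rotation_in_boundary_set[OF p \<omega>(1)] by (auto simp: odometer_orbit_def)
  ultimately show thesis using that \<omega>(1) finite_subset by blast
qed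

theorem proposition3p6:
  fixes x :: "int \<Rightarrow> 'a::finite" and p :: "nat \<Rightarrow> nat"
  assumes "generalised_oxtoby x" and "period_structure x p"
  shows "(\<forall>y \<in> orbit_closure x. Aper_total p y = {} \<or> infinite (Aper_total p y)) \<and>
         \<not> (\<forall>\<omega> \<in> odometer p. finite (odometer_orbit p \<omega> \<inter> boundary_set p x)) \<and>
         \<not> finite (boundary_set p x)"
proof -
  obtain q where ox: "generalised_oxtoby_wrt x q"
    using assms(1) by (auto simp: generalised_oxtoby_def)
  obtain \<omega> where "\<omega> \<in> odometer p" "infinite (odometer_orbit p \<omega> \<inter> boundary_set p x)"
    using oxtoby_infinite_orbit_boundary[OF ox assms(2)] .
  moreover have "\<forall>y \<in> orbit_closure x. Aper_total p y = {} \<or> infinite (Aper_total p y)"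
    using oxtoby_Aper_total[OF ox] Aper_total_eq[OF assms(2) oxtoby_period_structure[OF ox]] by metis
  ultimately show ?thesis by blast
qed

end
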